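(* Let $d\geq 1$, $k\ge 1$, and let $\mathcal C$ be a $(d+1)$-dimensional real vector space of continuous real functions on $\mathbf R^k$ containing the constant functions. Let $\mathcal P=\{P_1,\dots,P_n\}\subset\mathbf R^k$ be a set of $n$ points which is $\mathcal C$-generic. Then the relation on $\mathcal P$ given by $P\sim_{\mathcal C}Q$ if either $P=Q$ or $$n_{\mathcal C}(P,Q)\equiv\binom{n-3}{d-1}\pmod 2$$ is an equivalence relation having at most two classes.
   Context: For a subset $S=\{P_{i_1},\dots,P_{i_d}\}$ of $d$ distinct points of $\mathcal P$, set $I(S)=\{f\in\mathcal C\mid f(P_{i_j})=0,\ j=1,\dots,d\}$. A set $\mathcal P\subset\mathbf R^k$ of $n$ points is $\mathcal C$-generic if for each subset $S$ of $d$ distinct points of $\mathcal P$ the space $I(S)$ is $1$-dimensional, and all $\binom{n}{d}$ lines $I(S)\subset\mathcal C$ obtained in this way are distinct. Given distinct $P,Q\in\mathcal P$, a set $S$ of $d$ distinct points of $\mathcal P$ is $\mathcal C$-separating (for $P,Q$) if $f(P)f(Q)<0$ for any $0\neq f\in I(S)$; $n_{\mathcal C}(P,Q)$ denotes the number of $\mathcal C$-separating subsets $S$ of $\mathcal P$. Convention: $\binom{m}{k}=m(m-1)\cdots(m-k+1)/k!$ for every integer $m$. *)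

theory Defs
  imports
    "HOL-Analysis.Analysis"
    "HOL-Library.Function_Algebras"
    "HOL-Number_Theory.Cong"
begin

text \<open>The pointwise additive structure on functions comes from \<open>Function_Algebras\<close>; with the
  pointwise scaling below, \<open>subspace\<close> and \<open>dim\<close> apply to sets of functions.
  As \<open>dim\<close> is \<open>0\<close> for infinite-dimensional sets, \<open>dim C = Suc d\<close> includes
  finite-dimensionality.\<close>

instantiation "fun" :: (type, real_vector) real_vector
begin

definition scaleR_fun :: "real \<Rightarrow> ('a \<Rightarrow> 'b) \<Rightarrow> 'a \<Rightarrow> 'b" where
  "scaleR_fun c f = (\<lambda>x. c *\<^sub>R f x)"

instance
  by standard (simp_all add: scaleR_fun_def fun_eq_iff scaleR_add_right scaleR_add_left)

end

definition vanishing_on :: "('a \<Rightarrow> real) set \<Rightarrow> 'a set \<Rightarrow> ('a \<Rightarrow> real) set" where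
  "vanishing_on C S = {f \<in> C. \<forall>x\<in>S. f x = 0}"

definition d_subsets :: "nat \<Rightarrow> 'a set \<Rightarrow> 'a set set" where
  "d_subsets d P = {S. S \<subseteq> P \<and> finite S \<and> card S = d}"

definition generic_points :: "('a \<Rightarrow> real) set \<Rightarrow> nat \<Rightarrow> 'a set \<Rightarrow> bool" where
  "generic_points C d P \<longleftrightarrow>
     (\<forall>S \<in> d_subsets d P. dim (vanishing_on C S) = 1) \<and>
     inj_on (vanishing_on C) (d_subsets d P)"

definition separating :: "('a \<Rightarrow> real) set \<Rightarrow> 'a \<Rightarrow> 'a \<Rightarrow> 'a set \<Rightarrow> bool" where
  "separating C p q S \<longleftrightarrow> (\<forall>f \<in> vanishing_on C S. f \<noteq> 0 \<longrightarrow> f p * f q < 0)"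

definition num_separating ::
    "('a \<Rightarrow> real) set \<Rightarrow> nat \<Rightarrow> 'a set \<Rightarrow> 'a \<Rightarrow> 'a \<Rightarrow> nat" where
  "num_separating C d P p q = card {S \<in> d_subsets d P. separating C p q S}"

text \<open>Falling-factorial binomial coefficient with integer upper argument (needed since
  \<open>card P - 3\<close> may be negative); the sort constraint on \<open>(gchoose)\<close> rules out \<open>int\<close>.
  The lemma shows that the division is exact.\<close>

definition int_choose :: "int \<Rightarrow> nat \<Rightarrow> int" where
  "int_choose m k = (\<Prod>i=0..<k. m - int i) div fact k"

lemma of_int_int_choose: "real_of_int (int_choose m k) = real_of_int m gchoose k"
  by (simp only: of_int_gbinomial [symmetric] int_choose_def gbinomial_prod_rev [where 'a = int])

definition sep_rel :: "('a \<Rightarrow> real) set \<Rightarrow> nat \<Rightarrow> 'a set \<Rightarrow> ('a \<times> 'a) set" where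
  "sep_rel C d P = {(p, q). p \<in> P \<and> q \<in> P \<and>
     (p = q \<or>
      [int (num_separating C d P p q) = int_choose (int (card P) - 3) (d - 1)] (mod 2))}"

end

theory Submission
  imports Defs
begin

text \<open>Both claims follow from one congruence: for pairwise distinct \<open>p, q, r \<in> P\<close>, with \<open>n\<close>
  points in total, the sum \<open>n\<^sub>C(p,q) + n\<^sub>C(q,r) + n\<^sub>C(p,r)\<close> has the parity of
  \<open>(n - 3) choose (d - 1)\<close> (lemma \<open>num_separating_triple\<close>). It says that among the three pairs
  an odd number (one or three) are related, which gives transitivity and rules out three pairwise
  unrelated points.

  To prove the congruence, sort the \<open>d\<close>-subsets \<open>S\<close> by how they meet \<open>{p, q, r}\<close>. A nonzero
  \<open>f \<in> C\<close> vanishing on \<open>S\<close> is unique up to scaling and vanishes at no further point of \<open>P\<close>.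
  If \<open>S\<close> avoids \<open>{p, q, r}\<close>, then \<open>f\<close> takes at most two signs on the three points, so \<open>S\<close> separates an even
  number of the pairs; if \<open>S\<close> contains at least two of the points, it separates none. What remains
  are the sets \<open>T \<union> {p}\<close>, \<open>T \<union> {q}\<close>, \<open>T \<union> {r}\<close>, where \<open>T\<close> runs over the
  \<open>(d-1)\<close>-subsets of \<open>P - {p, q, r}\<close>. If \<open>f\<close> and \<open>g\<close> are the functions for
  \<open>T \<union> {p}\<close> and \<open>T \<union> {q}\<close>, then \<open>g(r) f - f(r) g\<close> is the function for \<open>T \<union> {r}\<close>; comparing
  signs, each \<open>T\<close> contributes an odd number (lemma \<open>separating_insert_odd\<close>).\<close>

section \<open>Functions vanishing on a subset of a generic set\<close>

lemma generic_generator: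
  assumes "generic_points C d P" "S \<in> d_subsets d P"
  shows "\<exists>f\<in>vanishing_on C S. f \<noteq> 0 \<and> (\<forall>g\<in>vanishing_on C S. \<exists>c. g = c *\<^sub>R f)"
proof -
  have dim1: "dim (vanishing_on C S) = 1"
    using assms by (auto simp: generic_points_def)
  obtain B where B: "B \<subseteq> vanishing_on C S" "independent B" "vanishing_on C S \<subseteq> span B"
      "card B = dim (vanishing_on C S)"
    using basis_exists by blast
  obtain f where f: "B = {f}"
    using B(4) dim1 by (auto simp: card_Suc_eq numeral_eq_Suc)
  have "f \<noteq> 0"
    using B(2) f dependent_zero by blast
  moreover have "\<exists>c. g = c *\<^sub>R f" if "g \<in> vanishing_on C S" for g
    using that B(3) f by (auto simp: span_singleton)
  ultimately show ?thesis
    using B(1) f by blast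
qed

text \<open>If \<open>f\<close> also vanished at \<open>p\<close>, exchanging a point of \<open>S\<close> for \<open>p\<close> would give a second
  \<open>d\<close>-subset with the same line of functions.\<close>

lemma generic_nonzero_off:
  assumes "generic_points C d P" "d \<ge> 1"
    and S: "S \<in> d_subsets d P" and f: "f \<in> vanishing_on C S" "f \<noteq> 0"
    and p: "p \<in> P" "p \<notin> S"
  shows "f p \<noteq> 0"
proof
  assume fp: "f p = 0"
  have finS: "finite S" "card S = d" "S \<subseteq> P"
    using S by (auto simp: d_subsets_def)
  then obtain s where s: "s \<in> S"
    using \<open>d \<ge> 1\<close> by fastforce
  define S' where "S' = insert p (S - {s})"
  have S': "S' \<in> d_subsets d P"
    using finS s p \<open>d \<ge> 1\<close> by (auto simp: S'_def d_subsets_def card_insert_if)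
  have f': "f \<in> vanishing_on C S'"
    using f fp by (auto simp: S'_def vanishing_on_def)
  obtain g where g: "\<And>h. h \<in> vanishing_on C S \<Longrightarrow> \<exists>c. h = c *\<^sub>R g"
    using generic_generator[OF assms(1) S] by blast
  obtain g' where g': "\<And>h. h \<in> vanishing_on C S' \<Longrightarrow> \<exists>c. h = c *\<^sub>R g'"
    using generic_generator[OF assms(1) S'] by blast
  have multiple: "\<exists>c. h = c *\<^sub>R f"
    if line: "\<And>h. h \<in> V \<Longrightarrow> \<exists>c. h = c *\<^sub>R g" and fV: "f \<in> V" and h: "h \<in> V" for V h g
  proof -
    obtain a b where ab: "f = a *\<^sub>R g" "h = b *\<^sub>R g"
      using line[OF fV] line[OF h] by blast
    with f(2) have "a \<noteq> 0" by auto
    then have "h = (b / a) *\<^sub>R f"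
      using ab by simp
    then show ?thesis ..
  qed
  have "vanishing_on C S = vanishing_on C S'"
  proof (intro equalityI subsetI)
    fix h assume h: "h \<in> vanishing_on C S"
    obtain c where "h = c *\<^sub>R f"
      using multiple[OF g f(1) h] by blast
    then show "h \<in> vanishing_on C S'"
      using f' h by (auto simp: vanishing_on_def scaleR_fun_def)
  next
    fix h assume h: "h \<in> vanishing_on C S'"
    obtain c where "h = c *\<^sub>R f"
      using multiple[OF g' f' h] by blast
    then show "h \<in> vanishing_on C S"
      using f h by (auto simp: vanishing_on_def scaleR_fun_def)
  qed
  then have "S = S'"
    using assms(1) S S' by (auto simp: generic_points_def dest: inj_onD)
  then show False
    using p by (auto simp: S'_def)
qed

lemma separating_iff:
  assumes "generic_points C d P" "S \<in> d_subsets d P" "f \<in> vanishing_on C S" "f \<noteq> 0"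
  shows "separating C p q S \<longleftrightarrow> f p * f q < 0"
proof
  assume "separating C p q S"
  then show "f p * f q < 0"
    using assms by (auto simp: separating_def)
next
  assume neg: "f p * f q < 0"
  obtain b where b: "\<And>g. g \<in> vanishing_on C S \<Longrightarrow> \<exists>c. g = c *\<^sub>R b"
    using generic_generator[OF assms(1,2)] by blast
  obtain a where a: "f = a *\<^sub>R b"
    using b assms(3) by blast
  have "a^2 * (b p * b q) < 0"
    using neg by (simp add: a scaleR_fun_def power2_eq_square mult_ac)
  then have b_neg: "b p * b q < 0"
    by (simp add: mult_less_0_iff)
  show "separating C p q S"
    unfolding separating_def
  proof (intro ballI impI)
    fix g assume g: "g \<in> vanishing_on C S" "g \<noteq> 0"
    obtain c where c: "g = c *\<^sub>R b"
      using b g(1) by blast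
    with g(2) have "c \<noteq> 0" by auto
    then have "c^2 * (b p * b q) < 0"
      using b_neg by (simp add: mult_less_0_iff)
    then show "g p * g q < 0"
      by (simp add: c scaleR_fun_def power2_eq_square mult_ac)
  qed
qed

section \<open>Separating subsets for a triple of points\<close>

lemma separating_commute: "separating C p q S \<longleftrightarrow> separating C q p S"
  by (simp add: separating_def mult.commute)

lemma num_separating_commute: "num_separating C d P p q = num_separating C d P q p"
  by (simp add: num_separating_def separating_commute)

lemma separating_notin:
  assumes "generic_points C d P" "S \<in> d_subsets d P" "separating C p q S"
  shows "p \<notin> S" "q \<notin> S"
proof -
  obtain f where f: "f \<in> vanishing_on C S" "f \<noteq> 0"
    using generic_generator[OF assms(1,2)] by blast
  then have "f p * f q < 0"
    using assms(3) unfolding separating_def by blast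
  then show "p \<notin> S" "q \<notin> S"
    using f(1) by (auto simp: vanishing_on_def)
qed

lemma separating_disjoint_even:
  assumes gen: "generic_points C d P" "d \<ge> 1"
    and S: "S \<in> d_subsets d P"
    and pqr: "p \<in> P - S" "q \<in> P - S" "r \<in> P - S"
  shows "even (of_bool (separating C p q S) + of_bool (separating C q r S)
             + of_bool (separating C p r S) :: nat)"
proof -
  obtain f where f: "f \<in> vanishing_on C S" "f \<noteq> 0"
    using generic_generator[OF gen(1) S] by blast
  have "f p \<noteq> 0" "f q \<noteq> 0" "f r \<noteq> 0"
    using generic_nonzero_off[OF gen S f] pqr by auto
  then show ?thesis
    by (auto simp: separating_iff[OF gen(1) S f] mult_less_0_iff)
qed

lemma separating_insert_odd:
  assumes gen: "generic_points C d P" "d \<ge> 1" "subspace C"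
    and T: "T \<in> d_subsets (d - 1) (P - {p, q, r})"
    and pqr: "p \<in> P" "q \<in> P" "r \<in> P" "p \<noteq> q" "q \<noteq> r" "p \<noteq> r"
  shows "odd (of_bool (separating C p q (insert r T)) + of_bool (separating C q r (insert p T))
            + of_bool (separating C p r (insert q T)) :: nat)"
proof -
  have ins: "insert x T \<in> d_subsets d P" if "x \<in> {p, q, r}" for x
    using T that pqr \<open>d \<ge> 1\<close> by (auto simp: d_subsets_def card_insert_if)
  have Sp: "insert p T \<in> d_subsets d P" and Sq: "insert q T \<in> d_subsets d P"
    and Sr: "insert r T \<in> d_subsets d P"
    using ins by auto
  have disj: "p \<notin> T" "q \<notin> T" "r \<notin> T"
    using T by (auto simp: d_subsets_def)
  obtain f where f: "f \<in> vanishing_on C (insert p T)" "f \<noteq> 0"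
    using generic_generator[OF gen(1) Sp] by blast
  obtain g where g: "g \<in> vanishing_on C (insert q T)" "g \<noteq> 0"
    using generic_generator[OF gen(1) Sq] by blast
  have f_nz: "f q \<noteq> 0" "f r \<noteq> 0"
    using generic_nonzero_off[OF gen(1,2) Sp f] pqr disj by auto
  have g_nz: "g p \<noteq> 0" "g r \<noteq> 0"
    using generic_nonzero_off[OF gen(1,2) Sq g] pqr disj by auto
  \<comment> \<open>a combination of \<open>f\<close> and \<open>g\<close> that vanishes at \<open>r\<close>\<close>
  define h where "h = g r *\<^sub>R f - f r *\<^sub>R g"
  have h_apply: "h x = g r * f x - f r * g x" for x
    by (simp add: h_def scaleR_fun_def)
  have "h \<in> C"
    using f(1) g(1) \<open>subspace C\<close>
    by (auto simp: h_def vanishing_on_def intro!: subspace_diff subspace_scale)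
  then have h: "h \<in> vanishing_on C (insert r T)"
    using f(1) g(1) by (auto simp: vanishing_on_def h_apply)
  have hp: "h p = - (f r * g p)" and hq: "h q = g r * f q"
    using f(1) g(1) by (auto simp: vanishing_on_def h_apply)
  have "h p \<noteq> 0"
    using hp f_nz g_nz by simp
  then have "h \<noteq> 0"
    by auto
  define x where "x = f q * f r"
  define y where "y = g p * g r"
  have xy: "x \<noteq> 0" "y \<noteq> 0"
    using f_nz g_nz by (simp_all add: x_def y_def)
  have "h p * h q = - (x * y)"
    by (simp add: hp hq x_def y_def)
  then have "separating C p q (insert r T) \<longleftrightarrow> (x < 0 \<longleftrightarrow> y < 0)"
    using xy by (auto simp: separating_iff[OF gen(1) Sr h \<open>h \<noteq> 0\<close>] zero_less_mult_iff)
  moreover have "separating C q r (insert p T) \<longleftrightarrow> x < 0"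
    unfolding separating_iff[OF gen(1) Sp f] x_def ..
  moreover have "separating C p r (insert q T) \<longleftrightarrow> y < 0"
    unfolding separating_iff[OF gen(1) Sq g] y_def ..
  ultimately show ?thesis
    by auto
qed

text \<open>A set separating \<open>p\<close> and \<open>q\<close> contains neither, so it is determined by its trace outside
  \<open>{p, q, r}\<close> and by whether it contains the third point \<open>r\<close>.\<close>

lemma num_separating_split:
  assumes gen: "generic_points C d P" "d \<ge> 1" and P: "finite P"
    and r: "r \<in> P" "p \<noteq> r" "q \<noteq> r"
    and X: "X = P - {p, q, r}"
  shows "num_separating C d P p q
       = (\<Sum>S\<in>d_subsets d X. of_bool (separating C p q S))
       + (\<Sum>T\<in>d_subsets (d - 1) X. of_bool (separating C p q (insert r T)))"
proof -
  have fin: "finite (d_subsets k Y)" if "Y \<subseteq> P" for k Y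
    using that P by (auto simp: d_subsets_def intro: finite_subset[of _ "Pow P"])
  have XP: "X \<subseteq> P" "r \<notin> X"
    using X by auto
  define A where "A = {S \<in> d_subsets d X. separating C p q S}"
  define B where "B = {T \<in> d_subsets (d - 1) X. separating C p q (insert r T)}"
  have eq: "{S \<in> d_subsets d P. separating C p q S} = A \<union> insert r ` B"
  proof (intro equalityI subsetI)
    fix S assume "S \<in> {S \<in> d_subsets d P. separating C p q S}"
    then have S: "S \<in> d_subsets d P" "separating C p q S" by auto
    note notin = separating_notin[OF gen(1) S]
    show "S \<in> A \<union> insert r ` B"
    proof (cases "r \<in> S")
      case True
      then have "S = insert r (S - {r})" by auto
      moreover have "S - {r} \<in> B"
        using S True notin by (auto simp: B_def d_subsets_def X insert_absorb)
      ultimately show ?thesis by blast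
    next
      case False
      then show ?thesis
        using S notin by (auto simp: A_def d_subsets_def X)
    qed
  next
    fix S assume "S \<in> A \<union> insert r ` B"
    then show "S \<in> {S \<in> d_subsets d P. separating C p q S}"
    proof
      assume "S \<in> A"
      then show ?thesis
        using XP by (auto simp: A_def d_subsets_def)
    next
      assume "S \<in> insert r ` B"
      then obtain T where T: "S = insert r T" "T \<in> B" by auto
      have "r \<notin> T"
        using T XP by (auto simp: B_def d_subsets_def)
      then show ?thesis
        using T XP r \<open>d \<ge> 1\<close> by (auto simp: B_def d_subsets_def)
    qed
  qed
  have "A \<inter> insert r ` B = {}"
    using XP by (auto simp: A_def d_subsets_def)
  moreover have "inj_on (insert r) B"
    using XP by (auto simp: inj_on_def B_def d_subsets_def insert_ident subset_iff)
  moreover have "finite A" "finite B"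
    using fin XP by (auto simp: A_def B_def)
  ultimately have "num_separating C d P p q = card A + card B"
    by (simp add: num_separating_def eq card_Un_disjoint card_image)
  also have "card A = (\<Sum>S\<in>d_subsets d X. of_bool (separating C p q S))"
    using fin XP by (simp add: A_def Int_def)
  also have "card B = (\<Sum>T\<in>d_subsets (d - 1) X. of_bool (separating C p q (insert r T)))"
    using fin XP by (simp add: B_def Int_def)
  finally show ?thesis .
qed

section \<open>The parity congruence\<close>

lemma even_sum_all_odd:
  fixes w :: "'b \<Rightarrow> nat"
  assumes "finite A" "\<And>x. x \<in> A \<Longrightarrow> odd (w x)"
  shows "even (sum w A) \<longleftrightarrow> even (card A)"
  using assms by (induction A rule: finite_induct) auto

lemma int_choose_of_nat: "int_choose (int m) k = int (m choose k)"
proof -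
  have "real_of_int (int_choose (int m) k) = real (m choose k)"
    by (simp add: of_int_int_choose binomial_gbinomial)
  then show ?thesis
    by linarith
qed

lemma num_separating_triple:
  assumes gen: "generic_points C d P" "d \<ge> 1" "subspace C" and P: "finite P"
    and pqr: "p \<in> P" "q \<in> P" "r \<in> P" "p \<noteq> q" "q \<noteq> r" "p \<noteq> r"
  shows "even (num_separating C d P p q + num_separating C d P q r + num_separating C d P p r)
     \<longleftrightarrow> even (int_choose (int (card P) - 3) (d - 1))"
proof -
  define X where "X = P - {p, q, r}"
  have finX: "finite X"
    using P by (simp add: X_def)
  have "card {p, q, r} \<le> card P"
    using P pqr by (intro card_mono) auto
  then have "card P \<ge> 3" and cardX: "card X = card P - 3"
    using P pqr by (auto simp: X_def card_Diff_subset)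
  then have choose: "int_choose (int (card P) - 3) (d - 1) = int (card X choose (d - 1))"
    using int_choose_of_nat[of "card P - 3"] by (simp add: of_nat_diff)
  have d_subsets_X: "d_subsets k X = {S. S \<subseteq> X \<and> card S = k}" for k
    using finX by (auto simp: d_subsets_def intro: finite_subset)
  have fin: "finite (d_subsets k X)" for k
    using finX by (simp add: d_subsets_X)
  define u :: "_ \<Rightarrow> nat" where "u S = of_bool (separating C p q S) + of_bool (separating C q r S)
      + of_bool (separating C p r S)" for S
  define v :: "_ \<Rightarrow> nat" where "v T = of_bool (separating C p q (insert r T))
      + of_bool (separating C q r (insert p T)) + of_bool (separating C p r (insert q T))" for T
  have X_eq: "X = P - {q, r, p}" "X = P - {p, r, q}"
    by (auto simp: X_def)
  have "num_separating C d P p q + num_separating C d P q r + num_separating C d P p r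
      = sum u (d_subsets d X) + sum v (d_subsets (d - 1) X)"
    using pqr
    by (simp add: num_separating_split[OF gen(1,2) P _ _ _ X_def]
        num_separating_split[OF gen(1,2) P _ _ _ X_eq(1)]
        num_separating_split[OF gen(1,2) P _ _ _ X_eq(2)] u_def v_def sum.distrib)
  moreover have "even (sum u (d_subsets d X))"
  proof (rule dvd_sum)
    fix S assume "S \<in> d_subsets d X"
    then show "even (u S)"
      unfolding u_def using pqr
      by (intro separating_disjoint_even[OF gen(1,2)]) (auto simp: d_subsets_def X_def)
  qed
  moreover have "even (sum v (d_subsets (d - 1) X)) \<longleftrightarrow> even (card (d_subsets (d - 1) X))"
  proof (rule even_sum_all_odd[OF fin])
    fix T assume "T \<in> d_subsets (d - 1) X"
    then show "odd (v T)"
      unfolding v_def X_def using pqr by (intro separating_insert_odd[OF gen])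
  qed
  moreover have "card (d_subsets (d - 1) X) = card X choose (d - 1)"
    unfolding d_subsets_X by (rule n_subsets[OF finX])
  ultimately show ?thesis
    unfolding choose by (metis even_add even_of_nat)
qed

section \<open>Relations with at most two classes\<close>

text \<open>Two related pairs in a triple force the third, which is transitivity, and no triple is
  pairwise unrelated, which bounds the number of classes.\<close>

lemma equiv_at_most_two_classes:
  assumes "refl_on A R" "R \<subseteq> A \<times> A" "sym R"
    and triple: "\<And>p q r. \<lbrakk>p \<in> A; q \<in> A; r \<in> A; p \<noteq> q; q \<noteq> r; p \<noteq> r\<rbrakk>
      \<Longrightarrow> odd (of_bool ((p, q) \<in> R) + of_bool ((q, r) \<in> R) + of_bool ((p, r) \<in> R) :: nat)"
  shows "equiv A R \<and> card (A // R) \<le> 2"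
proof
  have transitive: "(p, r) \<in> R" if "(p, q) \<in> R" "(q, r) \<in> R" for p q r
  proof (cases "p = q \<or> q = r \<or> p = r")
    case True
    then show ?thesis
      using that assms(1,2) by (auto dest: refl_onD)
  next
    case False
    have "p \<in> A" "q \<in> A" "r \<in> A"
      using that assms(2) by blast+
    then have "odd (1 + 1 + of_bool ((p, r) \<in> R) :: nat)"
      using triple[of p q r] that False by simp
    then show ?thesis
      by (cases "(p, r) \<in> R") simp_all
  qed
  then have "trans R"
    by (rule transI)
  then show equiv: "equiv A R"
    using assms(1-3) by (auto simp: equiv_def)
  have some_related: "(p, q) \<in> R \<or> (q, r) \<in> R \<or> (p, r) \<in> R" if "p \<in> A" "q \<in> A" "r \<in> A" for p q r
  proof (cases "p = q \<or> q = r \<or> p = r")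
    case True
    then show ?thesis
      using that assms(1) by (metis refl_onD)
  next
    case False
    then have "odd (of_bool ((p, q) \<in> R) + of_bool ((q, r) \<in> R) + of_bool ((p, r) \<in> R) :: nat)"
      using triple that by blast
    then show ?thesis
      by (rule contrapos_pp) simp
  qed
  \<comment> \<open>any unrelated pair represents all classes; without one, a single point does\<close>
  have "\<exists>p q. \<forall>x\<in>A. (p, x) \<in> R \<or> (q, x) \<in> R"
  proof (cases "\<exists>p\<in>A. \<exists>q\<in>A. (p, q) \<notin> R")
    case True
    then show ?thesis
      using some_related by blast
  next
    case False
    then show ?thesis
      by blast
  qed
  then obtain p q where pq: "\<And>x. x \<in> A \<Longrightarrow> (p, x) \<in> R \<or> (q, x) \<in> R"
    by blast
  have "A // R \<subseteq> {R `` {p}, R `` {q}}"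
  proof
    fix K assume "K \<in> A // R"
    then obtain x where x: "x \<in> A" "K = R `` {x}"
      by (rule quotientE)
    from pq[OF x(1)] show "K \<in> {R `` {p}, R `` {q}}"
      by (elim disjE) (simp_all add: x(2) equiv_class_eq[OF equiv])
  qed
  then have "card (A // R) \<le> card {R `` {p}, R `` {q}}"
    by (intro card_mono) auto
  also have "\<dots> \<le> 2"
    by (simp add: card_insert_if)
  finally show "card (A // R) \<le> 2" .
qed

theorem corollary1p6:
  fixes C :: "(real ^ 'k \<Rightarrow> real) set"
    and P :: "(real ^ 'k) set"
    and d :: nat
  assumes "d \<ge> 1"
    and "subspace C"
    and "dim C = d + 1"
    and "\<And>f. f \<in> C \<Longrightarrow> continuous_on UNIV f"
    and "\<And>c. (\<lambda>_. c) \<in> C"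
    and "finite P"
    and "generic_points C d P"
  shows "equiv P (sep_rel C d P) \<and> card (P // sep_rel C d P) \<le> 2"
proof (rule equiv_at_most_two_classes)
  show "refl_on P (sep_rel C d P)" "sep_rel C d P \<subseteq> P \<times> P" "sym (sep_rel C d P)"
    by (auto simp: refl_on_def sym_def sep_rel_def num_separating_commute)
next
  fix p q r assume pqr: "p \<in> P" "q \<in> P" "r \<in> P" "p \<noteq> q" "q \<noteq> r" "p \<noteq> r"
  have rel: "(x, y) \<in> sep_rel C d P \<longleftrightarrow>
      (even (num_separating C d P x y) \<longleftrightarrow> even (int_choose (int (card P) - 3) (d - 1)))"
    if "x \<in> P" "y \<in> P" "x \<noteq> y" for x y
    using that by (simp add: sep_rel_def cong_def) presburger
  show "odd (of_bool ((p, q) \<in> sep_rel C d P) + of_bool ((q, r) \<in> sep_rel C d P)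
           + of_bool ((p, r) \<in> sep_rel C d P) :: nat)"
    using num_separating_triple[OF assms(7,1,2,6) pqr]
    unfolding rel[OF pqr(1,2,4)] rel[OF pqr(2,3,5)] rel[OF pqr(1,3,6)]
    by (simp add: of_bool_def split: if_split) argo
qed

end
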